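(* On an almost Norden manifold $(M,J,g)\notin\mathcal W_2\oplus\mathcal W_3$ there exists a four-parametric family of completely symmetric connections $\nabla$, defined by $\nabla_XY=\nabla^0_XY+Q(X,Y)$ with difference tensor $$\begin{aligned}Q(X,Y)={}&\lambda_1[\theta(X)Y+\theta(Y)X+g(X,Y)\Omega]+\lambda_2[\theta(JX)Y+\theta(JY)X+g(X,Y)J\Omega]\\&+\lambda_3[\theta(X)JY+\theta(Y)JX+g(X,JY)\Omega]+\lambda_4[\theta(JX)JY+\theta(JY)JX+g(X,JY)J\Omega],\end{aligned}$$ $\lambda_i\in\mathbb R$ $(i=1,2,3,4)$; that is, for all $\lambda_1,\dots,\lambda_4\in\mathbb R$ this $\nabla$ is a completely symmetric connection.
   Context: An almost Norden manifold $(M,J,g)$ is a differentiable $2n$-dimensional manifold $M$ with an almost complex structure $J$ ($J^2=-\mathrm{id}$) and a pseudo-Riemannian metric $g$ such that $g(JX,JY)=-g(X,Y)$. Let $\nabla^0$ be the Levi-Civita connection of $g$ and $F(X,Y,Z)=g((\nabla^0_XJ)Y,Z)$. The Lie 1-form $\theta$ and the vector field $\Omega$ are defined by $\theta(X)=g^{ij}F(e_i,e_j,X)=g(X,\Omega)$, where $\{e_i\}$ is any local basis and $(g^{ij})$ is the inverse matrix of $(g(e_i,e_j))$. The class $\mathcal W_2\oplus\mathcal W_3$ (of the Ganchev–Borisov classification) consists of the almost Norden manifolds with $\theta=0$. A connection $\nabla=\nabla^0+Q$ is completely symmetric if it is torsion free and $Q(X,Y,Z)=g(Q(X,Y),Z)$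 is completely symmetric, i.e. $Q(X,Y,Z)=Q(Y,X,Z)=Q(X,Z,Y)$ (equivalently, $\nabla$ is torsion free and $(\nabla_Xg)(Y,Z)=(\nabla_Yg)(X,Z)$). *)

theory Defs
  imports "HOL-Analysis.Analysis" "HOL-Library.Function_Algebras"
begin

section \<open>Pointwise real vector space structure on functions\<close>

instantiation "fun" :: (type, scaleR) scaleR
begin

definition "scaleR c f = (\<lambda>x. c *\<^sub>R f x)"

instance ..

end

instance "fun" :: (type, real_vector) real_vector
  by standard
    (simp_all add: scaleR_fun_def plus_fun_def scaleR_add_left scaleR_add_right)

section \<open>Smooth manifolds\<close>

text \<open>\<open>Ck_on k S f\<close>: \<open>f\<close> is of class \<open>C^k\<close> on \<open>S\<close>.  It is only used for open \<open>S\<close>, where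
  differentiability within \<open>S\<close> and at a point of \<open>S\<close> agree.\<close>

primrec Ck_on ::
  "nat \<Rightarrow> 'a::euclidean_space set \<Rightarrow> ('a \<Rightarrow> 'b::real_normed_vector) \<Rightarrow> bool" where
  "Ck_on 0 = (\<lambda>S f. continuous_on S f)"
| "Ck_on (Suc k) = (\<lambda>S f. f differentiable_on S \<and>
     (\<forall>v. Ck_on k S (\<lambda>x. frechet_derivative f (at x) v)))"

definition smooth_on :: "'a::euclidean_space set \<Rightarrow> ('a \<Rightarrow> 'b::real_normed_vector) \<Rightarrow> bool" where
  "smooth_on S f \<longleftrightarrow> (\<forall>k. Ck_on k S f)"

type_synonym ('m, 'd) chart = "'m set \<times> ('m \<Rightarrow> real ^ 'd)"

definition is_chart :: "('m::topological_space, 'd::finite) chart \<Rightarrow> bool" where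
  "is_chart = (\<lambda>(U, \<phi>). open U \<and> open (\<phi> ` U) \<and> (\<exists>\<psi>. homeomorphism U (\<phi> ` U) \<phi> \<psi>))"

text \<open>The manifold is the whole type \<open>'m\<close>, of dimension \<open>CARD('d)\<close>; its smooth structure is the
  one generated by the atlas \<open>A\<close>, which need not be maximal.\<close>

definition smooth_atlas ::
  "('m::{t2_space, second_countable_topology}, 'd::finite) chart set \<Rightarrow> bool" where
  "smooth_atlas A \<longleftrightarrow>
     (\<forall>c\<in>A. is_chart c) \<and> (\<Union>(U, \<phi>)\<in>A. U) = UNIV \<and>
     (\<forall>(U, \<phi>)\<in>A. \<forall>(V, \<psi>)\<in>A. smooth_on (\<phi> ` (U \<inter> V)) (\<psi> \<circ> inv_into U \<phi>))"

definition smooth_fun ::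
  "('m::{t2_space, second_countable_topology}, 'd::finite) chart set \<Rightarrow> ('m \<Rightarrow> real) set" where
  "smooth_fun A = {f. \<forall>(U, \<phi>)\<in>A. smooth_on (\<phi> ` U) (f \<circ> inv_into U \<phi>)}"

text \<open>Tangent vectors at \<open>p\<close> are the derivations at \<open>p\<close> of the algebra of smooth functions.  Since HOL
  functions are total, they are required to vanish on non-smooth functions, so that equality of
  tangent vectors is equality of functions.\<close>

type_synonym 'm tangent = "('m \<Rightarrow> real) \<Rightarrow> real"

definition tangent_space ::
  "('m::{t2_space, second_countable_topology}, 'd::finite) chart set \<Rightarrow> 'm \<Rightarrow> 'm tangent set" where
  "tangent_space A p = {v.
     (\<forall>f\<in>smooth_fun A. \<forall>h\<in>smooth_fun A. \<forall>a b.
        v (\<lambda>x. a * f x + b * h x) = a * v f + b * v h) \<and>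
     (\<forall>f\<in>smooth_fun A. \<forall>h\<in>smooth_fun A.
        v (\<lambda>x. f x * h x) = v f * h p + f p * v h) \<and>
     (\<forall>f. f \<notin> smooth_fun A \<longrightarrow> v f = 0)}"

definition vector_fields ::
  "('m::{t2_space, second_countable_topology}, 'd::finite) chart set \<Rightarrow> ('m \<Rightarrow> 'm tangent) set" where
  "vector_fields A = {X. (\<forall>p. X p \<in> tangent_space A p) \<and>
     (\<forall>f\<in>smooth_fun A. (\<lambda>p. X p f) \<in> smooth_fun A)}"

definition lie_bracket :: "('m \<Rightarrow> 'm tangent) \<Rightarrow> ('m \<Rightarrow> 'm tangent) \<Rightarrow> 'm \<Rightarrow> 'm tangent" where
  "lie_bracket X Y = (\<lambda>p f. X p (\<lambda>q. Y q f) - Y p (\<lambda>q. X q f))"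

section \<open>Almost Norden manifolds\<close>

text \<open>Tensor fields are given pointwise; their values off the tangent spaces are irrelevant.  A tensor
  field is smooth if it yields a smooth result on smooth vector fields.\<close>

definition almost_complex_structure ::
  "('m::{t2_space, second_countable_topology}, 'd::finite) chart set \<Rightarrow>
   ('m \<Rightarrow> 'm tangent \<Rightarrow> 'm tangent) \<Rightarrow> bool" where
  "almost_complex_structure A J \<longleftrightarrow>
     (\<forall>p. \<forall>u\<in>tangent_space A p. J p u \<in> tangent_space A p \<and> J p (J p u) = - u) \<and>
     (\<forall>p. \<forall>u\<in>tangent_space A p. \<forall>v\<in>tangent_space A p. \<forall>a b.
        J p (a *\<^sub>R u + b *\<^sub>R v) = a *\<^sub>R J p u + b *\<^sub>R J p v) \<and>
     (\<forall>X\<in>vector_fields A. (\<lambda>p. J p (X p)) \<in> vector_fields A)"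

definition pseudo_riemannian_metric ::
  "('m::{t2_space, second_countable_topology}, 'd::finite) chart set \<Rightarrow>
   ('m \<Rightarrow> 'm tangent \<Rightarrow> 'm tangent \<Rightarrow> real) \<Rightarrow> bool" where
  "pseudo_riemannian_metric A g \<longleftrightarrow>
     (\<forall>p. \<forall>u\<in>tangent_space A p. \<forall>v\<in>tangent_space A p. g p u v = g p v u) \<and>
     (\<forall>p. \<forall>u\<in>tangent_space A p. \<forall>v\<in>tangent_space A p. \<forall>w\<in>tangent_space A p. \<forall>a b.
        g p (a *\<^sub>R u + b *\<^sub>R v) w = a * g p u w + b * g p v w) \<and>
     (\<forall>p. \<forall>u\<in>tangent_space A p. (\<forall>v\<in>tangent_space A p. g p u v = 0) \<longrightarrow> u = 0) \<and>
     (\<forall>X\<in>vector_fields A. \<forall>Y\<in>vector_fields A. (\<lambda>p. g p (X p) (Y p)) \<in> smooth_fun A)"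

definition almost_norden_manifold ::
  "('m::{t2_space, second_countable_topology}, 'd::finite) chart set \<Rightarrow>
   ('m \<Rightarrow> 'm tangent \<Rightarrow> 'm tangent) \<Rightarrow> ('m \<Rightarrow> 'm tangent \<Rightarrow> 'm tangent \<Rightarrow> real) \<Rightarrow> bool" where
  "almost_norden_manifold A J g \<longleftrightarrow>
     smooth_atlas A \<and> almost_complex_structure A J \<and> pseudo_riemannian_metric A g \<and>
     (\<forall>p. \<forall>u\<in>tangent_space A p. \<forall>v\<in>tangent_space A p. g p (J p u) (J p v) = - g p u v)"

section \<open>Connections\<close>

text \<open>Real linearity in the second argument is additivity together with the Leibniz rule for
  constant functions.\<close>

definition affine_connection ::
  "('m::{t2_space, second_countable_topology}, 'd::finite) chart set \<Rightarrow>
   (('m \<Rightarrow> 'm tangent) \<Rightarrow> ('m \<Rightarrow> 'm tangent) \<Rightarrow> 'm \<Rightarrow> 'm tangent) \<Rightarrow> bool" where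
  "affine_connection A D \<longleftrightarrow>
     (\<forall>X\<in>vector_fields A. \<forall>Y\<in>vector_fields A. D X Y \<in> vector_fields A) \<and>
     (\<forall>X\<in>vector_fields A. \<forall>X'\<in>vector_fields A. \<forall>Y\<in>vector_fields A.
        D (X + X') Y = D X Y + D X' Y) \<and>
     (\<forall>X\<in>vector_fields A. \<forall>Y\<in>vector_fields A. \<forall>Y'\<in>vector_fields A.
        D X (Y + Y') = D X Y + D X Y') \<and>
     (\<forall>X\<in>vector_fields A. \<forall>Y\<in>vector_fields A. \<forall>f\<in>smooth_fun A.
        D (\<lambda>p. f p *\<^sub>R X p) Y = (\<lambda>p. f p *\<^sub>R D X Y p) \<and>
        D X (\<lambda>p. f p *\<^sub>R Y p) = (\<lambda>p. X p f *\<^sub>R Y p + f p *\<^sub>R D X Y p))"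

definition torsion_free ::
  "('m::{t2_space, second_countable_topology}, 'd::finite) chart set \<Rightarrow>
   (('m \<Rightarrow> 'm tangent) \<Rightarrow> ('m \<Rightarrow> 'm tangent) \<Rightarrow> 'm \<Rightarrow> 'm tangent) \<Rightarrow> bool" where
  "torsion_free A D \<longleftrightarrow>
     (\<forall>X\<in>vector_fields A. \<forall>Y\<in>vector_fields A. D X Y - D Y X = lie_bracket X Y)"

definition levi_civita ::
  "('m::{t2_space, second_countable_topology}, 'd::finite) chart set \<Rightarrow>
   ('m \<Rightarrow> 'm tangent \<Rightarrow> 'm tangent \<Rightarrow> real) \<Rightarrow>
   (('m \<Rightarrow> 'm tangent) \<Rightarrow> ('m \<Rightarrow> 'm tangent) \<Rightarrow> 'm \<Rightarrow> 'm tangent) \<Rightarrow> bool" where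
  "levi_civita A g D \<longleftrightarrow>
     affine_connection A D \<and> torsion_free A D \<and>
     (\<forall>X\<in>vector_fields A. \<forall>Y\<in>vector_fields A. \<forall>Z\<in>vector_fields A. \<forall>p.
        X p (\<lambda>q. g q (Y q) (Z q)) = g p (D X Y p) (Z p) + g p (Y p) (D X Z p))"

text \<open>\<open>D0\<close> is the Levi-Civita connection, and \<open>Q = D - D0\<close> is the difference tensor.\<close>

definition completely_symmetric_connection ::
  "('m::{t2_space, second_countable_topology}, 'd::finite) chart set \<Rightarrow>
   ('m \<Rightarrow> 'm tangent \<Rightarrow> 'm tangent \<Rightarrow> real) \<Rightarrow>
   (('m \<Rightarrow> 'm tangent) \<Rightarrow> ('m \<Rightarrow> 'm tangent) \<Rightarrow> 'm \<Rightarrow> 'm tangent) \<Rightarrow>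
   (('m \<Rightarrow> 'm tangent) \<Rightarrow> ('m \<Rightarrow> 'm tangent) \<Rightarrow> 'm \<Rightarrow> 'm tangent) \<Rightarrow> bool" where
  "completely_symmetric_connection A g D0 D \<longleftrightarrow>
     affine_connection A D \<and> torsion_free A D \<and>
     (let Q = (\<lambda>X Y Z p. g p (D X Y p - D0 X Y p) (Z p)) in
      \<forall>X\<in>vector_fields A. \<forall>Y\<in>vector_fields A. \<forall>Z\<in>vector_fields A.
        Q X Y Z = Q Y X Z \<and> Q X Y Z = Q X Z Y)"

section \<open>The Lie form\<close>

definition fundamental_tensor ::
  "('m \<Rightarrow> 'm tangent \<Rightarrow> 'm tangent) \<Rightarrow> ('m \<Rightarrow> 'm tangent \<Rightarrow> 'm tangent \<Rightarrow> real) \<Rightarrow>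
   (('m \<Rightarrow> 'm tangent) \<Rightarrow> ('m \<Rightarrow> 'm tangent) \<Rightarrow> 'm \<Rightarrow> 'm tangent) \<Rightarrow>
   ('m \<Rightarrow> 'm tangent) \<Rightarrow> ('m \<Rightarrow> 'm tangent) \<Rightarrow> ('m \<Rightarrow> 'm tangent) \<Rightarrow> 'm \<Rightarrow> real" where
  "fundamental_tensor J g D X Y Z =
     (\<lambda>p. g p (D X (\<lambda>q. J q (Y q)) p - J p (D X Y p)) (Z p))"

text \<open>A local basis over \<open>U\<close> consists of globally defined vector fields that form a basis of the
  tangent space at every point of \<open>U\<close>.  By smooth cut-off, every vector field defined near a point
  agrees near that point with a global one, so this is no restriction for pointwise formulas.\<close>

definition local_frame ::
  "('m::{t2_space, second_countable_topology}, 'd::finite) chart set \<Rightarrow> 'm set \<Rightarrow>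
   ('d \<Rightarrow> 'm \<Rightarrow> 'm tangent) \<Rightarrow> bool" where
  "local_frame A U e \<longleftrightarrow> open U \<and> (\<forall>i. e i \<in> vector_fields A) \<and>
     (\<forall>p\<in>U. inj (\<lambda>i. e i p) \<and> independent (range (\<lambda>i. e i p)) \<and>
        span (range (\<lambda>i. e i p)) = tangent_space A p)"

definition one_form ::
  "('m::{t2_space, second_countable_topology}, 'd::finite) chart set \<Rightarrow>
   ('m \<Rightarrow> 'm tangent \<Rightarrow> real) \<Rightarrow> bool" where
  "one_form A \<theta> \<longleftrightarrow>
     (\<forall>p. \<forall>u\<in>tangent_space A p. \<forall>v\<in>tangent_space A p. \<forall>a b.
        \<theta> p (a *\<^sub>R u + b *\<^sub>R v) = a * \<theta> p u + b * \<theta> p v) \<and>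
     (\<forall>X\<in>vector_fields A. (\<lambda>p. \<theta> p (X p)) \<in> smooth_fun A)"

definition lie_form ::
  "('m::{t2_space, second_countable_topology}, 'd::finite) chart set \<Rightarrow>
   ('m \<Rightarrow> 'm tangent \<Rightarrow> 'm tangent) \<Rightarrow> ('m \<Rightarrow> 'm tangent \<Rightarrow> 'm tangent \<Rightarrow> real) \<Rightarrow>
   (('m \<Rightarrow> 'm tangent) \<Rightarrow> ('m \<Rightarrow> 'm tangent) \<Rightarrow> 'm \<Rightarrow> 'm tangent) \<Rightarrow>
   ('m \<Rightarrow> 'm tangent \<Rightarrow> real) \<Rightarrow> bool" where
  "lie_form A J g D0 \<theta> \<longleftrightarrow> one_form A \<theta> \<and>
     (\<forall>U e. local_frame A U e \<longrightarrow> (\<forall>p\<in>U. \<forall>X\<in>vector_fields A.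
        \<theta> p (X p) = (\<Sum>i\<in>UNIV. \<Sum>j\<in>UNIV.
          matrix_inv (\<chi> i j. g p (e i p) (e j p)) $ i $ j *
          fundamental_tensor J g D0 (e i) (e j) X p)))"

definition lie_vector_field ::
  "('m::{t2_space, second_countable_topology}, 'd::finite) chart set \<Rightarrow>
   ('m \<Rightarrow> 'm tangent \<Rightarrow> 'm tangent \<Rightarrow> real) \<Rightarrow>
   ('m \<Rightarrow> 'm tangent \<Rightarrow> real) \<Rightarrow> ('m \<Rightarrow> 'm tangent) \<Rightarrow> bool" where
  "lie_vector_field A g \<theta> \<Omega> \<longleftrightarrow> \<Omega> \<in> vector_fields A \<and>
     (\<forall>p. \<forall>u\<in>tangent_space A p. \<theta> p u = g p u (\<Omega> p))"

text \<open>The class of almost Norden manifolds with vanishing Lie form; the Levi-Civita connection and the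
  Lie form are unique (on vector fields and on tangent vectors, respectively).\<close>

definition class_W2_W3 ::
  "('m::{t2_space, second_countable_topology}, 'd::finite) chart set \<Rightarrow>
   ('m \<Rightarrow> 'm tangent \<Rightarrow> 'm tangent) \<Rightarrow> ('m \<Rightarrow> 'm tangent \<Rightarrow> 'm tangent \<Rightarrow> real) \<Rightarrow> bool" where
  "class_W2_W3 A J g \<longleftrightarrow> almost_norden_manifold A J g \<and>
     (\<forall>D0 \<theta>. levi_civita A g D0 \<and> lie_form A J g D0 \<theta> \<longrightarrow>
        (\<forall>p. \<forall>u\<in>tangent_space A p. \<theta> p u = 0))"

end

theory Submission
  imports Defs
begin

text \<open>Lowering an index with \<open>g\<close>, each of the four summands becomes a cyclic sum
  \<open>\<alpha>(X) h(Y,Z) + \<alpha>(Y) h(Z,X) + \<alpha>(Z) h(X,Y)\<close>, where \<open>\<alpha>\<close> is \<open>\<theta>\<close> or \<open>\<theta> \<circ> J\<close> and \<open>h\<close> is \<open>g\<close> or the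
  twin metric \<open>g(\<sqdot>, J\<sqdot>)\<close>.  The Norden condition makes \<open>J\<close> self-adjoint, so \<open>h\<close> is symmetric, and
  \<open>J\<Omega>\<close> is dual to \<open>\<theta> \<circ> J\<close>.\<close>

section \<open>Algebra of smooth functions and vector fields\<close>

text \<open>Since S is open, the derivative at a point of S depends only on values in S. This
  matters because \<open>frechet_derivative\<close> is total: the sum and product rules are
  available only at points of S, and this lemma confines their use to S.\<close>

lemma Ck_on_cong:
  assumes "open S" "Ck_on k S f" "\<And>x. x \<in> S \<Longrightarrow> f x = h x"
  shows "Ck_on k S h"
  using assms(2,3)
proof (induction k arbitrary: f h)
  case 0
  then show ?case using continuous_on_cong[of S S f h] by simp
next
  case (Suc k)
  have D: "frechet_derivative f (at x) = frechet_derivative h (at x)" if "x \<in> S" for x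
  proof -
    \<comment> \<open>\<open>frechet_derivative\<close> chooses some map satisfying
      \<open>has_derivative\<close>, so equivalence of the two predicates already makes the chosen
      maps equal.\<close>
    have "(f has_derivative D) (at x) \<longleftrightarrow> (h has_derivative D) (at x)" for D
      using has_derivative_transform_within_open[OF _ assms(1) that] Suc.prems(2) by metis
    then show ?thesis by (simp add: frechet_derivative_def)
  qed
  have "h differentiable_on S"
    using Suc.prems has_derivative_transform[of _ S h f]
    unfolding differentiable_on_def differentiable_def by (metis Ck_on.simps(2) differentiable_on_def differentiable_def)
  moreover have "Ck_on k S (\<lambda>x. frechet_derivative h (at x) v)" for v
    using Suc.IH[of "\<lambda>x. frechet_derivative f (at x) v"] Suc.prems(1) D by simp
  ultimately show ?case by simp
qed

text \<open>Needed for the product rule, where each factor also occurs undifferentiated and must be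
  lowered from order k + 1 to order k. The base case is continuity of differentiable maps.\<close>

lemma Ck_on_Suc_imp: "Ck_on (Suc k) S f \<Longrightarrow> Ck_on k S f"
proof (induction k arbitrary: f)
  case 0
  then show ?case by (simp add: differentiable_imp_continuous_on)
next
  case (Suc k)
  then show ?case by (metis Ck_on.simps(2))
qed

lemma Ck_on_const: "Ck_on k S (\<lambda>x. c)"
  by (induction k arbitrary: c) (simp_all add: frechet_derivative_const)

lemma Ck_on_add:
  assumes "open S" "Ck_on k S f" "Ck_on k S h"
  shows "Ck_on k S (\<lambda>x. f x + h x)"
  using assms(2,3)
proof (induction k arbitrary: f h)
  case 0
  then show ?case by (simp add: continuous_on_add)
next
  case (Suc k)
  have *: "f differentiable at x" "h differentiable at x" if "x \<in> S" for x
    using Suc.prems that assms(1) by (auto simp: differentiable_on_eq_differentiable_at)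
  have "Ck_on k S (\<lambda>x. frechet_derivative (\<lambda>x. f x + h x) (at x) v)" for v
  proof (rule Ck_on_cong[OF assms(1)])
    show "Ck_on k S (\<lambda>x. frechet_derivative f (at x) v + frechet_derivative h (at x) v)"
      using Suc by simp
    show "frechet_derivative f (at x) v + frechet_derivative h (at x) v =
        frechet_derivative (\<lambda>x. f x + h x) (at x) v" if "x \<in> S" for x
      using frechet_derivative_at[OF has_derivative_add[OF
            frechet_derivative_works[THEN iffD1, OF *(1)[OF that]] frechet_derivative_works[THEN iffD1, OF *(2)[OF that]]]]
      by metis
  qed
  with Suc.prems show ?case by (simp add: differentiable_on_add)
qed

lemma Ck_on_mult:
  fixes f h :: "_ \<Rightarrow> 'b::real_normed_algebra"
  assumes "open S" "Ck_on k S f" "Ck_on k S h"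
  shows "Ck_on k S (\<lambda>x. f x * h x)"
  using assms(2,3)
proof (induction k arbitrary: f h)
  case 0
  then show ?case by (simp add: continuous_on_mult)
next
  case (Suc k)
  have *: "f differentiable at x" "h differentiable at x" if "x \<in> S" for x
    using Suc.prems that assms(1) by (auto simp: differentiable_on_eq_differentiable_at)
  have "Ck_on k S (\<lambda>x. frechet_derivative (\<lambda>x. f x * h x) (at x) v)" for v
  proof (rule Ck_on_cong[OF assms(1)])
    \<comment> \<open>The Leibniz formula expresses the derivative by products of C^k maps, so the
      induction hypothesis applies to each product separately; this is why f and h are generalized
      in the induction.\<close>
    show "Ck_on k S (\<lambda>x. f x * frechet_derivative h (at x) v + frechet_derivative f (at x) v * h x)"
      using Suc Ck_on_Suc_imp[OF Suc.prems(1)] Ck_on_Suc_imp[OF Suc.prems(2)]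
      by (intro Ck_on_add assms(1)) auto
    show "f x * frechet_derivative h (at x) v + frechet_derivative f (at x) v * h x =
        frechet_derivative (\<lambda>x. f x * h x) (at x) v" if "x \<in> S" for x
      using frechet_derivative_at[OF has_derivative_mult[OF
            frechet_derivative_works[THEN iffD1, OF *(1)[OF that]] frechet_derivative_works[THEN iffD1, OF *(2)[OF that]]]]
      by metis
  qed
  with Suc.prems show ?case by (simp add: differentiable_on_mult)
qed

section \<open>Smooth functions, tangent vectors and vector fields on a manifold\<close>

context
  fixes A :: "('m::{t2_space, second_countable_topology}, 'd::finite) chart set"
begin

lemma smooth_fun_const: "(\<lambda>p. c) \<in> smooth_fun A"
  by (auto simp: smooth_fun_def smooth_on_def comp_def Ck_on_const)

text \<open>Passing to chart coordinates commutes with pointwise operations, and the image of a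
  chart is open, so the Euclidean closure property transfers chart by chart.\<close>

lemma smooth_fun_add:
  assumes "smooth_atlas A" "f \<in> smooth_fun A" "h \<in> smooth_fun A"
  shows "(\<lambda>p. f p + h p) \<in> smooth_fun A"
  using assms
  by (fastforce simp: smooth_fun_def smooth_on_def comp_def smooth_atlas_def is_chart_def
      intro!: Ck_on_add)

lemma smooth_fun_mult:
  assumes "smooth_atlas A" "f \<in> smooth_fun A" "h \<in> smooth_fun A"
  shows "(\<lambda>p. f p * h p) \<in> smooth_fun A"
  using assms
  by (fastforce simp: smooth_fun_def smooth_on_def comp_def smooth_atlas_def is_chart_def
      intro!: Ck_on_mult)

lemma tangent_space_add:
  "u \<in> tangent_space A p \<Longrightarrow> v \<in> tangent_space A p \<Longrightarrow> u + v \<in> tangent_space A p"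
  by (simp add: tangent_space_def plus_fun_def algebra_simps)

lemma tangent_space_scaleR: "u \<in> tangent_space A p \<Longrightarrow> c *\<^sub>R u \<in> tangent_space A p"
  by (simp add: tangent_space_def scaleR_fun_def algebra_simps)

lemma vector_fieldsD: "X \<in> vector_fields A \<Longrightarrow> X p \<in> tangent_space A p"
  by (simp add: vector_fields_def)

lemma vector_fields_add:
  assumes "smooth_atlas A" "X \<in> vector_fields A" "Y \<in> vector_fields A"
  shows "(\<lambda>p. X p + Y p) \<in> vector_fields A"
  using assms smooth_fun_add[OF assms(1)]
  by (simp add: vector_fields_def tangent_space_add)

lemma vector_fields_scaleR:
  assumes "smooth_atlas A" "f \<in> smooth_fun A" "X \<in> vector_fields A"
  shows "(\<lambda>p. f p *\<^sub>R X p) \<in> vector_fields A"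
  using assms smooth_fun_mult[OF assms(1)]
  by (simp add: vector_fields_def tangent_space_scaleR) (simp add: scaleR_fun_def)

section \<open>Connections and difference tensors\<close>

text \<open>B acts pointwise and bilinearly, hence is linear over smooth functions: the derivative
  term of the Leibniz rule comes from D alone and is left unchanged.\<close>

lemma affine_connection_add_tensor:
  fixes B :: "'m \<Rightarrow> 'm tangent \<Rightarrow> 'm tangent \<Rightarrow> 'm tangent"
  assumes "smooth_atlas A" and D: "affine_connection A D"
    and B: "\<And>X Y. X \<in> vector_fields A \<Longrightarrow> Y \<in> vector_fields A \<Longrightarrow>
        (\<lambda>p. B p (X p) (Y p)) \<in> vector_fields A"
    and add: "\<And>p u v w. u \<in> tangent_space A p \<Longrightarrow> v \<in> tangent_space A p \<Longrightarrow>
        w \<in> tangent_space A p \<Longrightarrow> B p (u + v) w = B p u w + B p v w"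
    and scaleR: "\<And>p u v c. u \<in> tangent_space A p \<Longrightarrow> v \<in> tangent_space A p \<Longrightarrow>
        B p (c *\<^sub>R u) v = c *\<^sub>R B p u v"
    and sym: "\<And>p u v. u \<in> tangent_space A p \<Longrightarrow> v \<in> tangent_space A p \<Longrightarrow> B p u v = B p v u"
  shows "affine_connection A (\<lambda>X Y p. D X Y p + B p (X p) (Y p))"
proof -
  \<comment> \<open>Symmetry carries linearity from the first slot to the second.\<close>
  have add': "B p w (u + v) = B p w u + B p w v"
    if "u \<in> tangent_space A p" "v \<in> tangent_space A p" "w \<in> tangent_space A p" for p u v w
    using that by (metis add sym tangent_space_add)
  have scaleR': "B p u (c *\<^sub>R v) = c *\<^sub>R B p u v"
    if "u \<in> tangent_space A p" "v \<in> tangent_space A p" for p u v c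
    using that by (metis scaleR sym tangent_space_scaleR)
  show ?thesis
    unfolding affine_connection_def
  proof (intro conjI ballI)
    fix X Y
    assume XY: "X \<in> vector_fields A" "Y \<in> vector_fields A"
    show "(\<lambda>p. D X Y p + B p (X p) (Y p)) \<in> vector_fields A"
      using vector_fields_add[OF assms(1)] B D XY by (simp add: affine_connection_def)
    fix Z
    assume Z: "Z \<in> vector_fields A"
    have "D (X + Y) Z = D X Z + D Y Z" "D X (Y + Z) = D X Y + D X Z"
      using D XY Z by (simp_all add: affine_connection_def)
    \<comment> \<open>Vector fields and tangent vectors are both functions, so addition is pointwise
      at two levels. The instantiated \<open>plus_fun_def\<close> opens only the sum of fields and
      leaves a sum of tangent vectors to which additivity of B applies.\<close>
    moreover have "B p ((X + Y) p) (Z p) = B p (X p) (Z p) + B p (Y p) (Z p)"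
      "B p (X p) ((Y + Z) p) = B p (X p) (Y p) + B p (X p) (Z p)" for p
      using add add' vector_fieldsD XY Z by (simp_all add: plus_fun_def[of X Y] plus_fun_def[of Y Z])
    ultimately show
      "(\<lambda>p. D (X + Y) Z p + B p ((X + Y) p) (Z p)) =
       (\<lambda>p. D X Z p + B p (X p) (Z p)) + (\<lambda>p. D Y Z p + B p (Y p) (Z p))"
      "(\<lambda>p. D X (Y + Z) p + B p (X p) ((Y + Z) p)) =
       (\<lambda>p. D X Y p + B p (X p) (Y p)) + (\<lambda>p. D X Z p + B p (X p) (Z p))"
      by (auto simp: plus_fun_def add_ac)
  next
    fix X Y f
    assume XY: "X \<in> vector_fields A" "Y \<in> vector_fields A" and f: "f \<in> smooth_fun A"
    have "D (\<lambda>p. f p *\<^sub>R X p) Y = (\<lambda>p. f p *\<^sub>R D X Y p)"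
      "D X (\<lambda>p. f p *\<^sub>R Y p) = (\<lambda>p. X p f *\<^sub>R Y p + f p *\<^sub>R D X Y p)"
      using D XY f by (simp_all add: affine_connection_def)
    then show
      "(\<lambda>p. D (\<lambda>p. f p *\<^sub>R X p) Y p + B p (f p *\<^sub>R X p) (Y p)) =
       (\<lambda>p. f p *\<^sub>R (D X Y p + B p (X p) (Y p)))"
      "(\<lambda>p. D X (\<lambda>p. f p *\<^sub>R Y p) p + B p (X p) (f p *\<^sub>R Y p)) =
       (\<lambda>p. X p f *\<^sub>R Y p + f p *\<^sub>R (D X Y p + B p (X p) (Y p)))"
      using scaleR scaleR' vector_fieldsD XY by (simp_all add: scaleR_add_right add.assoc)
  qed
qed

text \<open>A symmetric B cancels from the antisymmetrization in X and Y, so the torsion does not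
  change.\<close>

lemma torsion_free_add_tensor:
  fixes B :: "'m \<Rightarrow> 'm tangent \<Rightarrow> 'm tangent \<Rightarrow> 'm tangent"
  assumes D: "torsion_free A D"
    and sym: "\<And>p u v. u \<in> tangent_space A p \<Longrightarrow> v \<in> tangent_space A p \<Longrightarrow> B p u v = B p v u"
  shows "torsion_free A (\<lambda>X Y p. D X Y p + B p (X p) (Y p))"
  unfolding torsion_free_def
proof (intro ballI)
  fix X Y
  assume XY: "X \<in> vector_fields A" "Y \<in> vector_fields A"
  have "B p (X p) (Y p) = B p (Y p) (X p)" for p
    using sym vector_fieldsD XY by simp
  then have "(\<lambda>p. D X Y p + B p (X p) (Y p)) - (\<lambda>p. D Y X p + B p (Y p) (X p)) = D X Y - D Y X"
    by (simp add: fun_diff_def)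
  with D XY show "(\<lambda>p. D X Y p + B p (X p) (Y p)) - (\<lambda>p. D Y X p + B p (Y p) (X p)) =
      lie_bracket X Y"
    by (simp add: torsion_free_def)
qed

text \<open>The difference tensor of the new connection is B itself, which reduces the claim to
  smoothness of B and algebraic identities in each tangent space. The last two assumptions are the
  two transpositions that generate all permutations of the three slots.\<close>

lemma completely_symmetric_connection_add_tensor:
  fixes B :: "'m \<Rightarrow> 'm tangent \<Rightarrow> 'm tangent \<Rightarrow> 'm tangent"
  assumes "smooth_atlas A" "affine_connection A D" "torsion_free A D"
    and "\<And>X Y. X \<in> vector_fields A \<Longrightarrow> Y \<in> vector_fields A \<Longrightarrow>
        (\<lambda>p. B p (X p) (Y p)) \<in> vector_fields A"
    and "\<And>p u v w. u \<in> tangent_space A p \<Longrightarrow> v \<in> tangent_space A p \<Longrightarrow>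
        w \<in> tangent_space A p \<Longrightarrow> B p (u + v) w = B p u w + B p v w"
    and "\<And>p u v c. u \<in> tangent_space A p \<Longrightarrow> v \<in> tangent_space A p \<Longrightarrow>
        B p (c *\<^sub>R u) v = c *\<^sub>R B p u v"
    and "\<And>p u v. u \<in> tangent_space A p \<Longrightarrow> v \<in> tangent_space A p \<Longrightarrow> B p u v = B p v u"
    and "\<And>p u v w. u \<in> tangent_space A p \<Longrightarrow> v \<in> tangent_space A p \<Longrightarrow>
        w \<in> tangent_space A p \<Longrightarrow> g p (B p u v) w = g p (B p u w) v"
  shows "completely_symmetric_connection A g D (\<lambda>X Y p. D X Y p + B p (X p) (Y p))"
  using affine_connection_add_tensor[of D B] torsion_free_add_tensor[of D B] assms vector_fieldsD
  unfolding completely_symmetric_connection_def Let_def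
  by simp

text \<open>Apply the Norden condition to Ju and v, and replace J(Ju) by -u.\<close>

lemma almost_norden_self_adjoint:
  assumes "almost_norden_manifold A J g" "u \<in> tangent_space A p" "v \<in> tangent_space A p"
  shows "g p (J p u) v = g p u (J p v)"
proof -
  have "J p u \<in> tangent_space A p" "J p v \<in> tangent_space A p" "J p (J p u) = - u"
    using assms by (auto simp: almost_norden_manifold_def almost_complex_structure_def)
  moreover from this have "g p (J p (J p u)) (J p v) = - g p (J p u) v"
    using assms unfolding almost_norden_manifold_def by blast
  \<comment> \<open>Linearity of g is given for two-term combinations; coefficients -1 and 0 extract
    g(-u, Jv) = -g(u, Jv).\<close>
  moreover have "g p ((-1) *\<^sub>R u + 0 *\<^sub>R u) (J p v) = (-1) * g p u (J p v) + 0 * g p u (J p v)"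
    using assms calculation(2)
    unfolding almost_norden_manifold_def pseudo_riemannian_metric_def by blast
  ultimately show ?thesis by simp
qed

end

section \<open>The four-parametric family of completely symmetric connections\<close>

theorem proposition4p2:
  fixes A :: "('m::{t2_space, second_countable_topology}, 'd::finite) chart set"
    and J :: "'m \<Rightarrow> 'm tangent \<Rightarrow> 'm tangent"
    and g :: "'m \<Rightarrow> 'm tangent \<Rightarrow> 'm tangent \<Rightarrow> real"
    and D0 :: "('m \<Rightarrow> 'm tangent) \<Rightarrow> ('m \<Rightarrow> 'm tangent) \<Rightarrow> 'm \<Rightarrow> 'm tangent"
    and \<theta> :: "'m \<Rightarrow> 'm tangent \<Rightarrow> real"
    and \<Omega> :: "'m \<Rightarrow> 'm tangent"
    and n :: nat
  assumes "CARD('d) = 2 * n"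
    and "almost_norden_manifold A J g"
    and "levi_civita A g D0"
    and "lie_form A J g D0 \<theta>"
    and "lie_vector_field A g \<theta> \<Omega>"
    and "\<not> class_W2_W3 A J g"
  shows "\<forall>l1 l2 l3 l4 :: real.
    completely_symmetric_connection A g D0 (\<lambda>X Y p. D0 X Y p +
      (l1 *\<^sub>R (\<theta> p (X p) *\<^sub>R Y p + \<theta> p (Y p) *\<^sub>R X p + g p (X p) (Y p) *\<^sub>R \<Omega> p)
     + l2 *\<^sub>R (\<theta> p (J p (X p)) *\<^sub>R Y p + \<theta> p (J p (Y p)) *\<^sub>R X p + g p (X p) (Y p) *\<^sub>R J p (\<Omega> p))
     + l3 *\<^sub>R (\<theta> p (X p) *\<^sub>R J p (Y p) + \<theta> p (Y p) *\<^sub>R J p (X p) + g p (X p) (J p (Y p)) *\<^sub>R \<Omega> p)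
     + l4 *\<^sub>R (\<theta> p (J p (X p)) *\<^sub>R J p (Y p) + \<theta> p (J p (Y p)) *\<^sub>R J p (X p)
          + g p (X p) (J p (Y p)) *\<^sub>R J p (\<Omega> p))))"
proof (intro allI)
  fix l1 l2 l3 l4 :: real
  \<comment> \<open>The difference tensor as a map on tangent vectors at a point, so that its
    identities can be checked without vector fields.\<close>
  define B where "B = (\<lambda>p u v.
       l1 *\<^sub>R (\<theta> p u *\<^sub>R v + \<theta> p v *\<^sub>R u + g p u v *\<^sub>R \<Omega> p)
     + l2 *\<^sub>R (\<theta> p (J p u) *\<^sub>R v + \<theta> p (J p v) *\<^sub>R u + g p u v *\<^sub>R J p (\<Omega> p))
     + l3 *\<^sub>R (\<theta> p u *\<^sub>R J p v + \<theta> p v *\<^sub>R J p u + g p u (J p v) *\<^sub>R \<Omega> p)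
     + l4 *\<^sub>R (\<theta> p (J p u) *\<^sub>R J p v + \<theta> p (J p v) *\<^sub>R J p u + g p u (J p v) *\<^sub>R J p (\<Omega> p)))"
  have atlas: "smooth_atlas A" and ac: "almost_complex_structure A J"
    and met: "pseudo_riemannian_metric A g"
    using assms(2) by (auto simp: almost_norden_manifold_def)
  have form: "one_form A \<theta>"
    using assms(4) by (simp add: lie_form_def)
  have \<Omega>: "\<Omega> \<in> vector_fields A" and dual: "\<And>p u. u \<in> tangent_space A p \<Longrightarrow> \<theta> p u = g p u (\<Omega> p)"
    using assms(5) by (auto simp: lie_vector_field_def)
  note \<Omega>_tangent = vector_fieldsD[OF \<Omega>]
  have J_tangent: "J p u \<in> tangent_space A p" if "u \<in> tangent_space A p" for p u
    using ac that by (simp add: almost_complex_structure_def)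
  note tangent = tangent_space_add tangent_space_scaleR J_tangent \<Omega>_tangent
  have J_lin: "J p (a *\<^sub>R u + b *\<^sub>R v) = a *\<^sub>R J p u + b *\<^sub>R J p v"
    if "u \<in> tangent_space A p" "v \<in> tangent_space A p" for p u v a b
    using ac that by (simp add: almost_complex_structure_def)
  \<comment> \<open>For J, \<theta> and g alike, coefficients 1 and 1 give additivity, and a second
    coefficient 0 gives homogeneity.\<close>
  have J_add: "J p (u + v) = J p u + J p v"
    if "u \<in> tangent_space A p" "v \<in> tangent_space A p" for p u v
    using J_lin[OF that, of 1 1] by simp
  have J_scaleR: "J p (c *\<^sub>R u) = c *\<^sub>R J p u" if "u \<in> tangent_space A p" for p u c
    using J_lin[OF that that, of c 0] by simp
  have \<theta>_lin: "\<theta> p (a *\<^sub>R u + b *\<^sub>R v) = a * \<theta> p u + b * \<theta> p v"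
    if "u \<in> tangent_space A p" "v \<in> tangent_space A p" for p u v a b
    using form that by (simp add: one_form_def)
  have \<theta>_add: "\<theta> p (u + v) = \<theta> p u + \<theta> p v"
    if "u \<in> tangent_space A p" "v \<in> tangent_space A p" for p u v
    using \<theta>_lin[OF that, of 1 1] by simp
  have \<theta>_scaleR: "\<theta> p (c *\<^sub>R u) = c * \<theta> p u" if "u \<in> tangent_space A p" for p u c
    using \<theta>_lin[OF that that, of c 0] by simp
  have g_lin: "g p (a *\<^sub>R u + b *\<^sub>R v) w = a * g p u w + b * g p v w"
    if "u \<in> tangent_space A p" "v \<in> tangent_space A p" "w \<in> tangent_space A p" for p u v w a b
    using met that by (simp add: pseudo_riemannian_metric_def)
  have g_add: "g p (u + v) w = g p u w + g p v w"
    if "u \<in> tangent_space A p" "v \<in> tangent_space A p" "w \<in> tangent_space A p" for p u v w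
    using g_lin[OF that, of 1 1] by simp
  have g_scaleR: "g p (c *\<^sub>R u) w = c * g p u w"
    if "u \<in> tangent_space A p" "w \<in> tangent_space A p" for p u w c
    using g_lin[OF that(1,1,2), of c 0] by simp
  have g_sym: "g p u v = g p v u"
    if "u \<in> tangent_space A p" "v \<in> tangent_space A p" for p u v
    using met that by (simp add: pseudo_riemannian_metric_def)
  note J_adj = almost_norden_self_adjoint[OF assms(2)]
  \<comment> \<open>Both sides equal g(Ju, v), by self-adjointness of J and by symmetry of
    g.\<close>
  have twin_sym: "g p u (J p v) = g p v (J p u)"
    if "u \<in> tangent_space A p" "v \<in> tangent_space A p" for p u v
    using J_adj[OF that] g_sym[OF J_tangent[OF that(1)] that(2)] by simp
  have "completely_symmetric_connection A g D0 (\<lambda>X Y p. D0 X Y p + B p (X p) (Y p))"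
  proof (rule completely_symmetric_connection_add_tensor[OF atlas])
    show "affine_connection A D0" "torsion_free A D0"
      using assms(3) by (auto simp: levi_civita_def)
  next
    fix X Y
    assume XY: "X \<in> vector_fields A" "Y \<in> vector_fields A"
    have J_field: "(\<lambda>p. J p (Z p)) \<in> vector_fields A" if "Z \<in> vector_fields A" for Z
      using ac that by (simp add: almost_complex_structure_def)
    have \<theta>_smooth: "(\<lambda>p. \<theta> p (Z p)) \<in> smooth_fun A" if "Z \<in> vector_fields A" for Z
      using form that by (simp add: one_form_def)
    have g_smooth: "(\<lambda>p. g p (Z p) (W p)) \<in> smooth_fun A"
      if "Z \<in> vector_fields A" "W \<in> vector_fields A" for Z W
      using met that by (simp add: pseudo_riemannian_metric_def)
    show "(\<lambda>p. B p (X p) (Y p)) \<in> vector_fields A"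
      \<comment> \<open>Every term is a smooth function times a smooth field; the parameters enter
        as constant smooth functions.\<close>
      unfolding B_def
      by (intro vector_fields_add[OF atlas] vector_fields_scaleR[OF atlas]
          smooth_fun_const \<theta>_smooth g_smooth J_field XY \<Omega>)
  next
    fix p u v w
    assume "u \<in> tangent_space A p" "v \<in> tangent_space A p" "w \<in> tangent_space A p"
    then show "B p (u + v) w = B p u w + B p v w"
      by (simp add: B_def tangent J_add \<theta>_add g_add algebra_simps)
  next
    fix p u v c
    assume "u \<in> tangent_space A p" "v \<in> tangent_space A p"
    then show "B p (c *\<^sub>R u) v = c *\<^sub>R B p u v"
      by (simp add: B_def tangent J_scaleR \<theta>_scaleR g_scaleR algebra_simps)
  next
    fix p u v
    assume uv: "u \<in> tangent_space A p" "v \<in> tangent_space A p"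
    \<comment> \<open>Exchanging u and v swaps the first two terms of each bracket and fixes the
      third, by symmetry of g or of the twin metric.\<close>
    show "B p u v = B p v u"
      by (simp add: B_def g_sym[OF uv] twin_sym[OF uv] add_ac)
  next
    fix p u v w
    assume uvw: "u \<in> tangent_space A p" "v \<in> tangent_space A p" "w \<in> tangent_space A p"
    \<comment> \<open>The lowered form of B, with J moved onto the last argument by self-adjointness
      wherever the bracket has Jx or Jy as a vector term.\<close>
    have low: "g p (B p x y) z =
         l1 * (\<theta> p x * g p y z + \<theta> p y * g p x z + \<theta> p z * g p x y)
       + l2 * (\<theta> p (J p x) * g p y z + \<theta> p (J p y) * g p x z + \<theta> p (J p z) * g p x y)
       + l3 * (\<theta> p x * g p y (J p z) + \<theta> p y * g p x (J p z) + \<theta> p z * g p x (J p y))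
       + l4 * (\<theta> p (J p x) * g p y (J p z) + \<theta> p (J p y) * g p x (J p z)
              + \<theta> p (J p z) * g p x (J p y))"
      if xyz: "x \<in> tangent_space A p" "y \<in> tangent_space A p" "z \<in> tangent_space A p" for x y z
    proof -
      \<comment> \<open>The second identity is g(J\<Omega>, z) = g(\<Omega>, Jz) =
        \<theta>(Jz).\<close>
      have "g p (\<Omega> p) z = \<theta> p z" "g p (J p (\<Omega> p)) z = \<theta> p (J p z)"
        using xyz by (simp_all add: dual J_adj tangent g_sym[OF \<Omega>_tangent])
      then show ?thesis
        using xyz by (simp add: B_def tangent g_add g_scaleR J_adj algebra_simps)
    qed
    \<comment> \<open>Exchanging v and w permutes the terms carrying the 1-form at v and at w; the
      term carrying it at u is fixed by symmetry of g or of the twin metric in v and w.\<close>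
    show "g p (B p u v) w = g p (B p u w) v"
      by (simp add: low uvw g_sym[OF uvw(2,3)] twin_sym[OF uvw(2,3)] algebra_simps)
  qed
  then show "completely_symmetric_connection A g D0 (\<lambda>X Y p. D0 X Y p +
      (l1 *\<^sub>R (\<theta> p (X p) *\<^sub>R Y p + \<theta> p (Y p) *\<^sub>R X p + g p (X p) (Y p) *\<^sub>R \<Omega> p)
     + l2 *\<^sub>R (\<theta> p (J p (X p)) *\<^sub>R Y p + \<theta> p (J p (Y p)) *\<^sub>R X p + g p (X p) (Y p) *\<^sub>R J p (\<Omega> p))
     + l3 *\<^sub>R (\<theta> p (X p) *\<^sub>R J p (Y p) + \<theta> p (Y p) *\<^sub>R J p (X p) + g p (X p) (J p (Y p)) *\<^sub>R \<Omega> p)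
     + l4 *\<^sub>R (\<theta> p (J p (X p)) *\<^sub>R J p (Y p) + \<theta> p (J p (Y p)) *\<^sub>R J p (X p)
          + g p (X p) (J p (Y p)) *\<^sub>R J p (\<Omega> p))))"
    unfolding B_def .
qed

end
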